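(* Let $\alpha\in(0,2)$ and $1\le p<\infty$. (i) $C^{\alpha,p}_{\mathbb{R}^{n+1}_+}(\varnothing)=0$. (ii) If $E_1\subseteq E_2\subset\mathbb{R}^{n+1}_+$, then $C^{\alpha,p}_{\mathbb{R}^{n+1}_+}(E_1)\le C^{\alpha,p}_{\mathbb{R}^{n+1}_+}(E_2)$. (iii) For any sequence $\{E_j\}_{j=1}^\infty$ of subsets of $\mathbb{R}^{n+1}_+$, $$C^{\alpha,p}_{\mathbb{R}^{n+1}_+}\Big(\bigcup_{j=1}^\infty E_j\Big)\le\sum_{j=1}^\infty C^{\alpha,p}_{\mathbb{R}^{n+1}_+}(E_j).$$ (iv) For any $E\subset\mathbb{R}^{n+1}_+$ and any $x_0\in\mathbb{R}^n$, $C^{\alpha,p}_{\mathbb{R}^{n+1}_+}(E+(x_0,0))=C^{\alpha,p}_{\mathbb{R}^{n+1}_+}(E)$.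
   Context: $\mathbb{R}^{n+1}_+:=\mathbb{R}^n\times(0,\infty)$, $n\ge1$. For $\alpha\in(0,2)$, $P_\alpha f(x,t)=\int_{\mathbb{R}^n}p^\alpha_t(x-y)f(y)\,dy$ with $p^\alpha_t(x)=c(n,\alpha)\,t^\alpha(|x|^2+t^2)^{-(n+\alpha)/2}$, $c(n,\alpha)=\frac{\Gamma((n+\alpha)/2)}{\pi^{n/2}\Gamma(\alpha/2)}$. For $1\le p<\infty$ and $E\subset\mathbb{R}^{n+1}_+$, $C^{\alpha,p}_{\mathbb{R}^{n+1}_+}(E):=\inf\{\|f\|^p_{L^p(\mathbb{R}^n)}:\ f\in L^p(\mathbb{R}^n),\ f\ge0,\ P_\alpha f(x,t)\ge1\text{ for all }(x,t)\in E\}$, with $C^{\alpha,p}_{\mathbb{R}^{n+1}_+}(E)=+\infty$ if no such $f$ exists. *)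

theory Defs
  imports "HOL-Analysis.Analysis"
begin

(* R^n is the type real ^ 'n with n = CARD('n) >= 1. *)

definition upper_half_space :: "((real ^ 'n) \<times> real) set"
  where "upper_half_space = UNIV \<times> {0<..}"

definition poisson_const :: "nat \<Rightarrow> real \<Rightarrow> real"
  where "poisson_const n \<alpha> = Gamma ((real n + \<alpha>) / 2) / (pi powr (real n / 2) * Gamma (\<alpha> / 2))"

definition poisson_kernel :: "real \<Rightarrow> real \<Rightarrow> real ^ 'n \<Rightarrow> real"
  where "poisson_kernel \<alpha> t x =
    poisson_const CARD('n) \<alpha> * t powr \<alpha> *
      ((norm x)\<^sup>2 + t\<^sup>2) powr (- (real CARD('n) + \<alpha>) / 2)"

(* The Bochner integral is 0 for a non-integrable integrand.  This convention plays no role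
   for alpha > 0, t > 0 and f in L^p with p >= 1: the kernel is then bounded and integrable,
   so the integrand is integrable by Hoelder's inequality. *)
definition poisson_ext :: "real \<Rightarrow> (real ^ 'n \<Rightarrow> real) \<Rightarrow> real ^ 'n \<Rightarrow> real \<Rightarrow> real"
  where "poisson_ext \<alpha> f x t = (LINT y|lebesgue. poisson_kernel \<alpha> t (x - y) * f y)"

(* Representatives of the elements of L^p, not classes modulo null sets. *)
definition Lp_space :: "real \<Rightarrow> (real ^ 'n \<Rightarrow> real) set"
  where "Lp_space p =
    {f. f \<in> borel_measurable lebesgue \<and> integrable lebesgue (\<lambda>x. \<bar>f x\<bar> powr p)}"

definition Lp_norm :: "real \<Rightarrow> (real ^ 'n \<Rightarrow> real) \<Rightarrow> real"
  where "Lp_norm p f = (LINT x|lebesgue. \<bar>f x\<bar> powr p) powr (1 / p)"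

(* Non-negativity of an element of L^p is understood almost everywhere. *)
definition admissible :: "real \<Rightarrow> real \<Rightarrow> ((real ^ 'n) \<times> real) set \<Rightarrow> (real ^ 'n \<Rightarrow> real) set"
  where "admissible \<alpha> p E =
    {f \<in> Lp_space p. (AE x in lebesgue. 0 \<le> f x) \<and> (\<forall>(x, t)\<in>E. 1 \<le> poisson_ext \<alpha> f x t)}"

(* Valued in ennreal, where the infimum of the empty set is infinity. *)
definition poisson_capacity :: "real \<Rightarrow> real \<Rightarrow> ((real ^ 'n) \<times> real) set \<Rightarrow> ennreal"
  where "poisson_capacity \<alpha> p E = (INF f\<in>admissible \<alpha> p E. ennreal (Lp_norm p f powr p))"

end

theory Submission
  imports Defs
begin

text \<open>Every \<open>f\<close> in \<open>L\<^sup>p\<close> is integrable against the Poisson kernel, because the kernel is bounded and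
  integrable and \<open>\<bar>f\<bar> \<le> 1 + \<bar>f\<bar> powr p\<close>; hence the extension is monotone in \<open>f\<close>.  Countable
  subadditivity follows by taking near-optimal \<open>f j\<close> for \<open>E j\<close> and the competitor
  \<open>(\<Sum>j. \<bar>f j\<bar> powr p) powr (1 / p)\<close>, which dominates every \<open>f j\<close>.\<close>

section \<open>Integrability of the Poisson kernel's profile\<close>

lemma ennreal_le_suminf:
  fixes f :: "nat \<Rightarrow> ennreal"
  shows "f k \<le> suminf f"
  using sum_le_suminf[of f "{k}"] by simp

text \<open>The integrand is bounded near \<open>c\<close> and decays like
  \<open>norm (c - y) powr (- s)\<close>, which is integrable at infinity because \<open>s\<close>
  exceeds the dimension. The Poisson kernel is the case where \<open>s\<close> is the dimension plus
  \<open>\<alpha>\<close>.\<close>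

lemma integrable_norm_sq_plus_powr:
  fixes c :: "'a :: euclidean_space" and t s :: real
  assumes t: "0 < t" and s: "real DIM('a) < s"
  shows "integrable lborel (\<lambda>y. ((norm (c - y))\<^sup>2 + t\<^sup>2) powr (- s / 2))"
proof (rule integrableI_bounded)
  define N where "N = DIM('a)"
  define V where "V = unit_ball_vol (real N)"
  define r where "r k = t * 2 ^ k" for k :: nat
  have r: "0 < r k" for k using t by (simp add: r_def)
  \<comment> \<open>\<open>r k / 2\<close> is the inner radius of the k-th dyadic shell, so
    \<open>a k\<close> bounds the integrand there; on the innermost ball \<open>k = 0\<close> it is
    \<open>t / 2\<close>, and the summand \<open>t\<^sup>2\<close> gives the bound.\<close>
  define a where "a k = (r k / 2) powr (- s)" for k
  have s0: "0 < s" using s by linarith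
  show "(\<lambda>y. ((norm (c - y))\<^sup>2 + t\<^sup>2) powr (- s / 2)) \<in> borel_measurable lborel"
    by measurable
  have decay: "(x\<^sup>2 + t\<^sup>2) powr (- s / 2) \<le> b powr (- s)"
    if "0 < b" "b \<le> x \<or> b \<le> t" "0 \<le> x" for b x :: real
  proof -
    have "b\<^sup>2 \<le> x\<^sup>2 + t\<^sup>2"
      using that t by (smt (verit) power_mono zero_le_power2)
    hence "(x\<^sup>2 + t\<^sup>2) powr (- s / 2) \<le> (b\<^sup>2) powr (- s / 2)"
      using that s0 by (intro powr_mono2') auto
    also have "\<dots> = b powr (- s)"
      using that by (simp add: powr_powr flip: powr_numeral)
    finally show ?thesis .
  qed
  \<comment> \<open>The dyadic balls of radii \<open>t * 2 ^ k\<close> give a majorant whose integral is a geometric series.\<close>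
  have pointwise: "ennreal (((norm (c - y))\<^sup>2 + t\<^sup>2) powr (- s / 2))
      \<le> (\<Sum>k. ennreal (a k) * indicator (cball c (r k)) y)" for y
  proof -
    obtain m :: nat where "norm (c - y) / t < 2 ^ m"
      using real_arch_pow[of 2 "norm (c - y) / t"] by auto
    hence ex: "norm (c - y) \<le> r m"
      using t by (simp add: r_def field_simps)
    \<comment> \<open>The first ball containing \<open>y\<close>: by minimality \<open>y\<close>
      lies outside the previous ball, whose radius is \<open>r k / 2\<close>.\<close>
    define k where "k = (LEAST k. norm (c - y) \<le> r k)"
    have k: "norm (c - y) \<le> r k"
      unfolding k_def by (rule LeastI) (rule ex)
    have "r k / 2 \<le> norm (c - y) \<or> r k / 2 \<le> t"
    proof (cases k)
      case 0
      thus ?thesis using t by (simp add: r_def)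
    next
      case (Suc j)
      hence "\<not> norm (c - y) \<le> r j"
        using not_less_Least[of j "\<lambda>k. norm (c - y) \<le> r k"] by (simp add: k_def)
      thus ?thesis using Suc by (simp add: r_def)
    qed
    hence "((norm (c - y))\<^sup>2 + t\<^sup>2) powr (- s / 2) \<le> a k"
      unfolding a_def using r[of k] by (intro decay) auto
    hence "ennreal (((norm (c - y))\<^sup>2 + t\<^sup>2) powr (- s / 2))
        \<le> ennreal (a k) * indicator (cball c (r k)) y"
      using k by (simp add: dist_norm ennreal_leI)
    also have "\<dots> \<le> (\<Sum>k. ennreal (a k) * indicator (cball c (r k)) y)"
      by (rule ennreal_le_suminf)
    finally show ?thesis .
  qed
  \<comment> \<open>Bound times volume of the k-th ball. The ratio
    \<open>2 powr (real N - s)\<close> is below 1 exactly because \<open>s\<close> exceeds the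
    dimension \<open>N\<close>.\<close>
  have geom: "a k * (V * r k ^ N) = V * (t / 2) powr (- s) * t ^ N * (2 powr (real N - s)) ^ k"
    for k
  proof -
    have "a k = (t / 2) powr (- s) * (2 ^ k) powr (- s)"
      using t unfolding a_def r_def by (subst powr_mult[symmetric]) auto
    moreover have "((2::real) ^ k) powr (- s) * (2 ^ k) ^ N = (2 powr (real N - s)) ^ k"
    proof -
      have "((2::real) ^ k) powr (- s) * (2 ^ k) ^ N
          = (2 powr real k) powr (- s) * (2 powr real k) powr real N"
        by (simp add: powr_realpow)
      also have "\<dots> = (2 powr (real N - s)) powr real k"
        by (simp add: powr_powr algebra_simps flip: powr_add)
      also have "\<dots> = (2 powr (real N - s)) ^ k"
        by (simp add: powr_realpow)
      finally show ?thesis .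
    qed
    ultimately show ?thesis
      by (simp add: r_def power_mult_distrib algebra_simps)
  qed
  have "summable (\<lambda>k. (2 powr (real N - s)) ^ k)"
    using s by (intro summable_geometric) (simp add: N_def powr_less_one)
  hence summ: "summable (\<lambda>k. a k * (V * r k ^ N))"
    unfolding geom by (rule summable_mult)
  have "(\<integral>\<^sup>+ y. ennreal (norm (((norm (c - y))\<^sup>2 + t\<^sup>2) powr (- s / 2))) \<partial>lborel)
      \<le> (\<integral>\<^sup>+ y. (\<Sum>k. ennreal (a k) * indicator (cball c (r k)) y) \<partial>lborel)"
    using pointwise by (intro nn_integral_mono) simp
  also have "\<dots> = (\<Sum>k. \<integral>\<^sup>+ y. ennreal (a k) * indicator (cball c (r k)) y \<partial>lborel)"
    by (intro nn_integral_suminf)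
      (auto intro!: borel_measurable_times_ennreal borel_measurable_indicator)
  also have "\<dots> = (\<Sum>k. ennreal (a k * (V * r k ^ N)))"
  proof (rule suminf_cong)
    fix k
    show "(\<integral>\<^sup>+ y. ennreal (a k) * indicator (cball c (r k)) y \<partial>lborel) = ennreal (a k * (V * r k ^ N))"
      using r[of k] by (subst nn_integral_cmult_indicator)
        (simp_all add: emeasure_cball V_def N_def ennreal_mult' a_def)
  qed
  also have "\<dots> = ennreal (\<Sum>k. a k * (V * r k ^ N))"
    using summ r less_imp_le[OF r]
    by (intro suminf_ennreal2) (auto simp: a_def V_def)
  also have "\<dots> < \<infinity>" by simp
  finally show "(\<integral>\<^sup>+ y. ennreal (norm (((norm (c - y))\<^sup>2 + t\<^sup>2) powr (- s / 2))) \<partial>lborel) < \<infinity>" .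
qed

section \<open>Bounds on the Poisson kernel and its pairing with functions in
  \<open>Lp_space p\<close>\<close>

lemma poisson_const_nonneg:
  assumes "0 < \<alpha>"
  shows "0 \<le> poisson_const n \<alpha>"
proof -
  have "0 < Gamma ((real n + \<alpha>) / 2)" "0 < Gamma (\<alpha> / 2)"
    using assms by (auto intro!: Gamma_real_pos)
  thus ?thesis by (simp add: poisson_const_def)
qed

lemma poisson_kernel_nonneg: "0 < \<alpha> \<Longrightarrow> 0 \<le> poisson_kernel \<alpha> t x"
  by (simp add: poisson_kernel_def poisson_const_nonneg)

lemma poisson_kernel_le:
  fixes x :: "real ^ 'n"
  assumes "0 < \<alpha>" "0 < t"
  shows "poisson_kernel \<alpha> t x \<le> poisson_kernel \<alpha> t (0 :: real ^ 'n)"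
proof -
  have "((norm x)\<^sup>2 + t\<^sup>2) powr (- (real CARD('n) + \<alpha>) / 2) \<le> (t\<^sup>2) powr (- (real CARD('n) + \<alpha>) / 2)"
    using assms by (intro powr_mono2') auto
  thus ?thesis
    using assms unfolding poisson_kernel_def
    by (intro mult_left_mono) (auto simp: poisson_const_nonneg)
qed

lemma integrable_poisson_kernel:
  fixes x :: "real ^ 'n"
  assumes "0 < \<alpha>" "0 < t"
  shows "integrable lebesgue (\<lambda>y. poisson_kernel \<alpha> t (x - y))"
proof -
  have "integrable lborel (\<lambda>y. poisson_kernel \<alpha> t (x - y))"
    unfolding poisson_kernel_def using assms
    by (intro integrable_mult_right integrable_norm_sq_plus_powr) auto
  thus ?thesis
    by (subst integrable_completion) (auto dest: borel_measurable_integrable)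
qed

lemma abs_le_one_plus_powr:
  fixes z p :: real
  assumes "1 \<le> p"
  shows "\<bar>z\<bar> \<le> 1 + \<bar>z\<bar> powr p"
proof (cases "\<bar>z\<bar> \<le> 1")
  case True
  thus ?thesis by (simp add: add_increasing2)
next
  case False
  hence "\<bar>z\<bar> powr 1 \<le> \<bar>z\<bar> powr p"
    using assms by (intro powr_mono) auto
  thus ?thesis using False by simp
qed

text \<open>In the majorant, the first term is integrable because the kernel is, the second because
  the kernel is at most its value at 0. No conjugate exponent enters, so \<open>p = 1\<close> is not
  a special case.\<close>

lemma integrable_poisson_kernel_mult:
  fixes f :: "real ^ 'n \<Rightarrow> real"
  assumes "0 < \<alpha>" "0 < t" "1 \<le> p" and f: "f \<in> Lp_space p"
  shows "integrable lebesgue (\<lambda>y. poisson_kernel \<alpha> t (x - y) * f y)"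
proof (rule Bochner_Integration.integrable_bound)
  let ?K = "\<lambda>y. poisson_kernel \<alpha> t (x - y)"
  show "integrable lebesgue (\<lambda>y. ?K y + poisson_kernel \<alpha> t (0 :: real ^ 'n) * \<bar>f y\<bar> powr p)"
    using f assms by (intro Bochner_Integration.integrable_add integrable_poisson_kernel
        integrable_mult_right) (auto simp: Lp_space_def)
  show "(\<lambda>y. ?K y * f y) \<in> borel_measurable lebesgue"
    using f borel_measurable_integrable[OF integrable_poisson_kernel[OF assms(1,2), of x]]
    by (auto simp: Lp_space_def intro: borel_measurable_times)
  show "AE y in lebesgue. norm (?K y * f y)
      \<le> norm (?K y + poisson_kernel \<alpha> t (0 :: real ^ 'n) * \<bar>f y\<bar> powr p)"
  proof (rule AE_I2)
    fix y
    have K: "0 \<le> ?K y" "?K y \<le> poisson_kernel \<alpha> t (0 :: real ^ 'n)"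
      using assms by (auto intro: poisson_kernel_nonneg poisson_kernel_le)
    have "?K y * \<bar>f y\<bar> \<le> ?K y * (1 + \<bar>f y\<bar> powr p)"
      using K assms(3) by (intro mult_left_mono abs_le_one_plus_powr)
    also have "\<dots> \<le> ?K y + poisson_kernel \<alpha> t (0 :: real ^ 'n) * \<bar>f y\<bar> powr p"
      using K by (simp add: distrib_left mult_right_mono)
    finally show "norm (?K y * f y)
        \<le> norm (?K y + poisson_kernel \<alpha> t (0 :: real ^ 'n) * \<bar>f y\<bar> powr p)"
      using K by (simp add: abs_mult)
  qed
qed

text \<open>Membership of both functions in \<open>Lp_space p\<close> makes both integrands
  integrable; otherwise the default value 0 of the integral could break monotonicity.\<close>

lemma poisson_ext_mono:
  fixes f g :: "real ^ 'n \<Rightarrow> real"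
  assumes "0 < \<alpha>" "0 < t" "1 \<le> p" "f \<in> Lp_space p" "g \<in> Lp_space p"
    and le: "AE y in lebesgue. f y \<le> g y"
  shows "poisson_ext \<alpha> f x t \<le> poisson_ext \<alpha> g x t"
  unfolding poisson_ext_def
proof (rule integral_mono_AE)
  show "AE y in lebesgue. poisson_kernel \<alpha> t (x - y) * f y \<le> poisson_kernel \<alpha> t (x - y) * g y"
    using le by eventually_elim (simp add: mult_left_mono poisson_kernel_nonneg assms)
qed (use assms in \<open>auto intro: integrable_poisson_kernel_mult\<close>)

text \<open>The exponents \<open>1 / p\<close> and \<open>p\<close> cancel. The nonnegative integral
  on the right commutes with countable sums, which is what subadditivity uses.\<close>

lemma Lp_norm_powr:
  assumes "f \<in> Lp_space p" "1 \<le> p"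
  shows "ennreal (Lp_norm p f powr p) = (\<integral>\<^sup>+ x. ennreal (\<bar>f x\<bar> powr p) \<partial>lebesgue)"
proof -
  have "Lp_norm p f powr p = (LINT x|lebesgue. \<bar>f x\<bar> powr p)"
    using assms by (simp add: Lp_norm_def powr_powr)
  thus ?thesis
    using assms by (simp add: Lp_space_def nn_integral_eq_integral)
qed

section \<open>Monotonicity, the empty set and countable subadditivity\<close>

lemma poisson_capacity_mono:
  assumes "E1 \<subseteq> E2"
  shows "poisson_capacity \<alpha> p E1 \<le> poisson_capacity \<alpha> p E2"
  unfolding poisson_capacity_def using assms
  by (intro INF_superset_mono) (auto simp: admissible_def)

lemma poisson_capacity_empty:
  "poisson_capacity \<alpha> p ({} :: ((real ^ 'n) \<times> real) set) = 0"
proof -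
  have "(\<lambda>_. 0) \<in> admissible \<alpha> p ({} :: ((real ^ 'n) \<times> real) set)"
    by (simp add: admissible_def Lp_space_def)
  hence "poisson_capacity \<alpha> p ({} :: ((real ^ 'n) \<times> real) set)
      \<le> ennreal (Lp_norm p (\<lambda>_ :: real ^ 'n. 0) powr p)"
    unfolding poisson_capacity_def by (rule INF_lower)
  thus ?thesis by (simp add: Lp_norm_def)
qed

text \<open>A supremum of the \<open>f j\<close> would also dominate them all, but the p-th power
  sum has an integral that is computed term by term.\<close>

lemma admissible_UN_exists:
  fixes E :: "nat \<Rightarrow> ((real ^ 'n) \<times> real) set"
  assumes "0 < \<alpha>" and p: "1 \<le> p" and E: "\<And>j. E j \<subseteq> upper_half_space"
    and f: "\<And>j. f j \<in> admissible \<alpha> p (E j)"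
    and fin: "(\<Sum>j. ennreal (Lp_norm p (f j) powr p)) < \<infinity>"
  shows "\<exists>g \<in> admissible \<alpha> p (\<Union>j. E j).
      ennreal (Lp_norm p g powr p) \<le> (\<Sum>j. ennreal (Lp_norm p (f j) powr p))"
proof
  have fL: "f j \<in> Lp_space p" for j using f by (simp add: admissible_def)
  hence meas [measurable]: "f j \<in> borel_measurable lebesgue" for j by (simp add: Lp_space_def)
  define h where "h x = (\<Sum>j. ennreal (\<bar>f j x\<bar> powr p))" for x
  have h_meas [measurable]: "h \<in> borel_measurable lebesgue"
    unfolding h_def by measurable
  \<comment> \<open>\<open>enn2real\<close> sends infinity to 0, so \<open>g\<close> dominates the
    \<open>f j\<close> only where \<open>h\<close> is finite. That is almost everywhere, since the
    integral of \<open>h\<close> is the finite sum in \<open>fin\<close>.\<close>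
  define g where "g x = enn2real (h x) powr (1 / p)" for x
  have g_meas [measurable]: "g \<in> borel_measurable lebesgue"
    unfolding g_def by measurable
  have h_int: "(\<integral>\<^sup>+ x. h x \<partial>lebesgue) = (\<Sum>j. ennreal (Lp_norm p (f j) powr p))"
    unfolding h_def by (subst nn_integral_suminf) (simp_all add: Lp_norm_powr[OF fL p])
  have h_fin: "AE x in lebesgue. h x \<noteq> \<infinity>"
    using fin h_int by (intro nn_integral_PInf_AE) auto
  have g_powr: "\<bar>g x\<bar> powr p = enn2real (h x)" for x
    using p by (simp add: g_def powr_powr)
  have g_le: "(\<integral>\<^sup>+ x. ennreal (\<bar>g x\<bar> powr p) \<partial>lebesgue) \<le> (\<integral>\<^sup>+ x. h x \<partial>lebesgue)"
    unfolding g_powr by (intro nn_integral_mono) (metis ennreal_enn2real_if le_cases top_greatest)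
  have gL: "g \<in> Lp_space p"
    unfolding Lp_space_def using order_le_less_trans[OF g_le] fin
    by (auto simp: h_int intro!: integrableI_bounded)
  have f_le: "AE x in lebesgue. f j x \<le> g x" for j
    using h_fin
  proof eventually_elim
    case (elim x)
    have "ennreal (\<bar>f j x\<bar> powr p) \<le> h x"
      unfolding h_def by (rule ennreal_le_suminf)
    hence "\<bar>f j x\<bar> powr p \<le> enn2real (h x)"
      using elim by (metis enn2real_ennreal enn2real_mono infinity_ennreal_def less_top powr_ge_zero)
    hence "(\<bar>f j x\<bar> powr p) powr (1 / p) \<le> g x"
      unfolding g_def using p by (intro powr_mono2) auto
    thus ?case using p by (simp add: powr_powr)
  qed
  have "1 \<le> poisson_ext \<alpha> g x t" if "(x, t) \<in> E j" for x t j
  proof -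
    have "0 < t" using that E[of j] by (auto simp: upper_half_space_def)
    have "1 \<le> poisson_ext \<alpha> (f j) x t" using f[of j] that by (auto simp: admissible_def)
    also have "\<dots> \<le> poisson_ext \<alpha> g x t"
      by (rule poisson_ext_mono[OF assms(1) \<open>0 < t\<close> p fL gL f_le])
    finally show ?thesis .
  qed
  thus "g \<in> admissible \<alpha> p (\<Union>j. E j)"
    using gL by (auto simp: admissible_def g_def)
  show "ennreal (Lp_norm p g powr p) \<le> (\<Sum>j. ennreal (Lp_norm p (f j) powr p))"
    using Lp_norm_powr[OF gL p] g_le h_int by simp
qed

lemma poisson_capacity_UN_le:
  fixes E :: "nat \<Rightarrow> ((real ^ 'n) \<times> real) set"
  assumes "0 < \<alpha>" "1 \<le> p" and E: "\<And>j. E j \<subseteq> upper_half_space"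
  shows "poisson_capacity \<alpha> p (\<Union>j. E j) \<le> (\<Sum>j. poisson_capacity \<alpha> p (E j))"
\<comment> \<open>This rule lets the right-hand side be assumed finite, so every single capacity is
  finite and its infimum can be approached by an admissible function.\<close>
proof (rule ennreal_le_epsilon)
  fix e :: real
  assume fin: "(\<Sum>j. poisson_capacity \<alpha> p (E j)) < top" and e: "0 < e"
  \<comment> \<open>Indices start at 0, so the exponent \<open>Suc j\<close> makes the errors add up
    to exactly \<open>e\<close>.\<close>
  define d where "d j = e * (1 / 2) ^ Suc j" for j
  have d: "0 < d j" for j using e by (simp add: d_def)
  have "poisson_capacity \<alpha> p (E j) \<noteq> \<infinity>" for j
  proof -
    have "poisson_capacity \<alpha> p (E j) \<le> (\<Sum>j. poisson_capacity \<alpha> p (E j))"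
      by (rule ennreal_le_suminf)
    thus ?thesis using fin by auto
  qed
  hence "\<exists>f \<in> admissible \<alpha> p (E j).
      ennreal (Lp_norm p f powr p) < poisson_capacity \<alpha> p (E j) + ennreal (d j)" for j
    using INF_approx_ennreal[OF d poisson_capacity_def] by blast
  then obtain f where f: "\<And>j. f j \<in> admissible \<alpha> p (E j)"
    and f_less: "\<And>j. ennreal (Lp_norm p (f j) powr p) < poisson_capacity \<alpha> p (E j) + ennreal (d j)"
    by metis
  have "d sums e"
    unfolding d_def using sums_mult[OF power_half_series, of e] by (simp only: mult_1_right)
  hence d_sum: "(\<Sum>j. ennreal (d j)) = ennreal e"
    by (subst suminf_ennreal2[OF less_imp_le[OF d]]) (auto simp only: sums_iff)
  have "(\<Sum>j. ennreal (Lp_norm p (f j) powr p))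
      \<le> (\<Sum>j. poisson_capacity \<alpha> p (E j) + ennreal (d j))"
    using f_less by (intro suminf_le) (auto intro: less_imp_le)
  also have "\<dots> = (\<Sum>j. poisson_capacity \<alpha> p (E j)) + ennreal e"
    by (simp add: d_sum flip: suminf_add)
  finally have le: "(\<Sum>j. ennreal (Lp_norm p (f j) powr p))
      \<le> (\<Sum>j. poisson_capacity \<alpha> p (E j)) + ennreal e" .
  hence "(\<Sum>j. ennreal (Lp_norm p (f j) powr p)) < \<infinity>"
    using fin by (simp add: order_le_less_trans)
  then obtain g where "g \<in> admissible \<alpha> p (\<Union>j. E j)"
    and "ennreal (Lp_norm p g powr p) \<le> (\<Sum>j. ennreal (Lp_norm p (f j) powr p))"
    using admissible_UN_exists[where f = f, OF assms f] by blast
  thus "poisson_capacity \<alpha> p (\<Union>j. E j) \<le> (\<Sum>j. poisson_capacity \<alpha> p (E j)) + ennreal e"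
    using le unfolding poisson_capacity_def by (meson INF_lower2 order_trans)
qed

section \<open>Translation invariance\<close>

lemma
  fixes c :: "'a :: euclidean_space"
  shows measurable_translation_lebesgue: "(+) c \<in> lebesgue \<rightarrow>\<^sub>M lebesgue"
    and distr_translation_lebesgue: "distr lebesgue lebesgue ((+) c) = lebesgue"
proof -
  \<comment> \<open>A translation is the affine map with all scaling factors 1, whose Jacobian, and
    hence density, is 1.\<close>
  have eq: "(\<lambda>x. c + (\<Sum>j\<in>Basis. (1 * (x \<bullet> j)) *\<^sub>R j)) = (+) c"
    by (simp add: euclidean_representation fun_eq_iff)
  show "(+) c \<in> lebesgue \<rightarrow>\<^sub>M lebesgue"
    using lebesgue_affine_measurable[of "\<lambda>_. 1" c] by (simp add: euclidean_representation eq)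
  show "distr lebesgue lebesgue ((+) c) = lebesgue"
    using lebesgue_affine_euclidean[of "\<lambda>_. 1" c]
    by (simp add: euclidean_representation eq density_1)
qed

lemma integral_translation_lebesgue:
  fixes f :: "'a :: euclidean_space \<Rightarrow> real"
  assumes "f \<in> borel_measurable lebesgue"
  shows "(LINT x|lebesgue. f (c + x)) = (LINT x|lebesgue. f x)"
  using integral_distr[OF measurable_translation_lebesgue assms, of c]
  by (simp add: distr_translation_lebesgue)

lemma translate_Lp_space:
  assumes "f \<in> Lp_space p"
  shows "(\<lambda>y. f (c + y)) \<in> Lp_space p"
proof -
  have "(\<lambda>y. f (c + y)) \<in> borel_measurable lebesgue"
    using measurable_compose[OF measurable_translation_lebesgue] assms by (auto simp: Lp_space_def)
  moreover have "integrable lebesgue (\<lambda>y. \<bar>f (c + y)\<bar> powr p)"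
    using integrable_distr[OF measurable_translation_lebesgue, of c "\<lambda>y. \<bar>f y\<bar> powr p"] assms
    by (simp add: distr_translation_lebesgue Lp_space_def)
  ultimately show ?thesis by (simp add: Lp_space_def)
qed

lemma Lp_norm_translate:
  assumes "f \<in> Lp_space p"
  shows "Lp_norm p (\<lambda>y. f (c + y)) = Lp_norm p f"
  using integral_translation_lebesgue[of "\<lambda>y. \<bar>f y\<bar> powr p" c] assms
  by (auto simp: Lp_norm_def Lp_space_def)

text \<open>The kernel sees only the difference of its two points, so shifting the integration
  variable by \<open>c\<close> shifts the evaluation point by \<open>c\<close>.\<close>

lemma poisson_ext_translate:
  fixes f :: "real ^ 'n \<Rightarrow> real"
  assumes "f \<in> borel_measurable lebesgue"
  shows "poisson_ext \<alpha> (\<lambda>y. f (c + y)) x t = poisson_ext \<alpha> f (c + x) t"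
proof -
  have "(\<lambda>y. poisson_kernel \<alpha> t (c + x - y)) \<in> borel_measurable borel"
    unfolding poisson_kernel_def by measurable
  hence "(\<lambda>y. poisson_kernel \<alpha> t (c + x - y) * f y) \<in> borel_measurable lebesgue"
    using assms by (intro borel_measurable_times) (auto intro: measurable_completion)
  from integral_translation_lebesgue[OF this, of c] show ?thesis
    by (simp add: poisson_ext_def)
qed

lemma poisson_capacity_translate_le:
  fixes E :: "((real ^ 'n) \<times> real) set"
  shows "poisson_capacity \<alpha> p ((\<lambda>z. z + (x0, 0)) ` E) \<le> poisson_capacity \<alpha> p E"
  unfolding poisson_capacity_def
proof (rule INF_mono)
  fix f assume f: "f \<in> admissible \<alpha> p E"
  hence fL: "f \<in> Lp_space p" by (simp add: admissible_def)
  hence meas: "f \<in> borel_measurable lebesgue" by (simp add: Lp_space_def)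
  \<comment> \<open>Moving \<open>f\<close> along with the set keeps its norm, and the extension of
    \<open>?g\<close> at \<open>x + x0\<close> is that of \<open>f\<close> at
    \<open>x\<close>.\<close>
  let ?g = "\<lambda>y. f (- x0 + y)"
  have "AE y in lebesgue. 0 \<le> ?g y"
    using f AE_distrD[OF measurable_translation_lebesgue[of "- x0"], where P = "\<lambda>y. 0 \<le> f y"]
    by (simp only: distr_translation_lebesgue admissible_def mem_Collect_eq)
  moreover have "poisson_ext \<alpha> ?g (x + x0) t = poisson_ext \<alpha> f x t" for x t
    using poisson_ext_translate[OF meas, of \<alpha> "- x0" "x + x0" t] by simp
  hence "\<forall>(x, t) \<in> (\<lambda>z. z + (x0, 0)) ` E. 1 \<le> poisson_ext \<alpha> ?g x t"
    using f by (fastforce simp: admissible_def)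
  ultimately have "?g \<in> admissible \<alpha> p ((\<lambda>z. z + (x0, 0)) ` E)"
    using translate_Lp_space[OF fL, of "- x0"] by (simp add: admissible_def)
  moreover have "ennreal (Lp_norm p ?g powr p) \<le> ennreal (Lp_norm p f powr p)"
    by (simp only: Lp_norm_translate[OF fL] order_refl)
  ultimately show "\<exists>g \<in> admissible \<alpha> p ((\<lambda>z. z + (x0, 0)) ` E).
      ennreal (Lp_norm p g powr p) \<le> ennreal (Lp_norm p f powr p)" by blast
qed

lemma poisson_capacity_translate:
  fixes E :: "((real ^ 'n) \<times> real) set"
  shows "poisson_capacity \<alpha> p ((\<lambda>z. z + (x0, 0)) ` E) = poisson_capacity \<alpha> p E"
proof (rule antisym[OF poisson_capacity_translate_le])
  \<comment> \<open>Shifting back by \<open>- x0\<close> recovers \<open>E\<close>, so the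
    inequality already proved, applied to the shifted set, gives the reverse one.\<close>
  have "(\<lambda>z. z + (- x0, 0)) ` (\<lambda>z. z + (x0, 0)) ` E = E"
    by (simp add: image_image add.assoc flip: zero_prod_def)
  thus "poisson_capacity \<alpha> p E \<le> poisson_capacity \<alpha> p ((\<lambda>z. z + (x0, 0)) ` E)"
    using poisson_capacity_translate_le[of \<alpha> p "- x0" "(\<lambda>z. z + (x0, 0)) ` E"] by simp
qed

theorem proposition2p3:
  fixes \<alpha> p :: real
  assumes "0 < \<alpha>" and "\<alpha> < 2" and "1 \<le> p"
  shows "poisson_capacity \<alpha> p ({} :: ((real ^ 'n) \<times> real) set) = 0
    \<and> (\<forall>E1 E2 :: ((real ^ 'n) \<times> real) set.
          E1 \<subseteq> E2 \<longrightarrow> E2 \<subseteq> upper_half_space \<longrightarrow>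
          poisson_capacity \<alpha> p E1 \<le> poisson_capacity \<alpha> p E2)
    \<and> (\<forall>E :: nat \<Rightarrow> ((real ^ 'n) \<times> real) set.
          (\<forall>j. E j \<subseteq> upper_half_space) \<longrightarrow>
          poisson_capacity \<alpha> p (\<Union>j. E j) \<le> (\<Sum>j. poisson_capacity \<alpha> p (E j)))
    \<and> (\<forall>(E :: ((real ^ 'n) \<times> real) set) (x0 :: real ^ 'n).
          E \<subseteq> upper_half_space \<longrightarrow>
          poisson_capacity \<alpha> p ((\<lambda>z. z + (x0, 0)) ` E) = poisson_capacity \<alpha> p E)"
  using assms
  by (simp add: poisson_capacity_empty poisson_capacity_mono poisson_capacity_UN_le
      poisson_capacity_translate)

end
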